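(* Let $G$ and $F$ be Abelian Cayley graphs (locally finite, simple and connected), let $\phi$ be a non-trivial connection on $G$ with values in $\mathrm{Aut}(F)$ that is balanced on every loop of length $4$ in $G$, and suppose that the graph bundle $G\times_\phi F$ is a discrete vector bundle. Then $G\times_\phi F$ is locally Abelian and is not (isomorphic to) an Abelian Cayley graph.
   Context: Abelian Cayley graph: For a group $A$ and a subset $\Gamma\subset A$ generating $A$, the Cayley graph $(A,\Gamma)$ has vertex set $A$, with $g_1\sim g_2$ if $g_1g_2^{-1}\in\Gamma$ or $g_2g_1^{-1}\in\Gamma$. It is an Abelian Cayley graph if $A$ is Abelian. Graph bundle: Let $G=(V_G,E_G)$ and $F=(V_F,E_F)$ be locally finite, simple, connected graphs and let $E_G^{or}=\{(x,y): x,y\in V_G,\ x\sim y\}$ be the set of oriented edges of $G$. A connection is a map $\phi:E_G^{or}\to \mathrm{Aut}(F)$, $(x,y)\mapsto\phi_{yx}$, into the group of graph automorphisms of $F$, such that $\phi_{xy}=\phi_{yx}^{-1}$. The graph bundle $G\times_\phi F$ is the graph with vertex set $V_G\times V_F$ in which $(x,v)\sim(y,w)$ if and only if either (i) $x=y$ and $v\sim w$ in $F$, or (ii) $x\sim y$ in $G$ and $w=\phi_{yx}(v)$. Let $\pi:V_G\times V_F\to V_G$ be the projection to the first factor. Equivalence and triviality: Two connections $\phi_1,\phi_2$ (for the same $G$ and $F$) are equivalent if there exists a graph isomorphism $\varphi$ from $G\times_{\phi_1}F$ to $G\times_{\phi_2}F$ with $\pi\circ\varphi=\pi$. The connection assigning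 the identity of $\mathrm{Aut}(F)$ to each oriented edge yields the Cartesian product $G\times F$; any connection equivalent to it is called trivial, and a connection (or its bundle) is non-trivial if the connection is not trivial. Discrete vector bundle: $G\times_\phi F$ is a discrete vector bundle if there exists a vertex $o\in V_F$ (the null element) such that $\phi_{yx}(o)=o$ for every $(x,y)\in E_G^{or}$. Balanced loops: A loop of length $N$ in $G$ is a sequence of vertices $\{x_i\}_{i=0}^N$ with $x_i\sim x_{i+1}$ for $0\le i\le N-1$ and $x_0=x_N$ (vertices may repeat). It is balanced (with respect to $\phi$) if $\phi_{x_Nx_{N-1}}\circ\cdots\circ\phi_{x_2x_1}\circ\phi_{x_1x_0}=\mathrm{id}\in\mathrm{Aut}(F)$. Locally Abelian (also called S-Ricci flat): A $d$-regular simple graph with vertex set $V$ is locally Abelian if for every $x\in V$, writing $B_1(x)=\{x\}\cup\{y\in V:y\sim x\}$, there exist maps $\eta_i:B_1(x)\to V$, $1\le i\le d$, such that (i) $\eta_i(u)\sim u$ for all $u\in B_1(x)$ and all $i$; (ii) for all $u\in B_1(x)$: $\eta_i(u)=\eta_j(u)$ if and only if $i=j$; (iii) for every $i$, $\bigcup_j\{\eta_i(\eta_j(x))\}=\bigcup_j\{\eta_j(\eta_i(x))\}$; (iv) $\eta_i(\eta_j(x))=\eta_j(\eta_i(x))$ for all $i,j$. *)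

theory Defs
  imports "HOL-Algebra.Generated_Groups" "HOL-Algebra.Bij"
begin

section \<open>Graphs\<close>

record 'a sgraph =
  verts :: "'a set"
  adj :: "'a \<Rightarrow> 'a \<Rightarrow> bool"

definition simple_graph :: "'a sgraph \<Rightarrow> bool" where
  "simple_graph G \<longleftrightarrow>
     (\<forall>x y. adj G x y \<longrightarrow> x \<in> verts G \<and> y \<in> verts G) \<and>
     (\<forall>x y. adj G x y \<longrightarrow> adj G y x) \<and>
     (\<forall>x. \<not> adj G x x)"

definition locally_finite_graph :: "'a sgraph \<Rightarrow> bool" where
  "locally_finite_graph G \<longleftrightarrow> (\<forall>x\<in>verts G. finite {y \<in> verts G. adj G x y})"

definition connected_graph :: "'a sgraph \<Rightarrow> bool" where
  "connected_graph G \<longleftrightarrow> (\<forall>x\<in>verts G. \<forall>y\<in>verts G. (adj G)\<^sup>*\<^sup>* x y)"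

definition regular_graph :: "nat \<Rightarrow> 'a sgraph \<Rightarrow> bool" where
  "regular_graph d G \<longleftrightarrow>
     (\<forall>x\<in>verts G. finite {y \<in> verts G. adj G x y} \<and> card {y \<in> verts G. adj G x y} = d)"

definition graph_iso :: "('a \<Rightarrow> 'b) \<Rightarrow> 'a sgraph \<Rightarrow> 'b sgraph \<Rightarrow> bool" where
  "graph_iso f G H \<longleftrightarrow>
     bij_betw f (verts G) (verts H) \<and>
     (\<forall>x\<in>verts G. \<forall>y\<in>verts G. adj G x y \<longleftrightarrow> adj H (f x) (f y))"

text \<open>As for \<^const>\<open>Bij\<close>, automorphisms are extensional functions, so that equality in the
  group is equality of maps on the vertex set.\<close>

definition graph_aut :: "'a sgraph \<Rightarrow> ('a \<Rightarrow> 'a) set" where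
  "graph_aut F = {f \<in> Bij (verts F). graph_iso f F F}"

definition graph_aut_group :: "'a sgraph \<Rightarrow> ('a \<Rightarrow> 'a) monoid" where
  "graph_aut_group F = BijGroup (verts F) \<lparr>carrier := graph_aut F\<rparr>"

lemma subgroup_graph_aut: "subgroup (graph_aut F) (BijGroup (verts F))"
proof (rule group.subgroupI)
  show "group (BijGroup (verts F))" by (rule group_BijGroup)
  show "graph_aut F \<subseteq> carrier (BijGroup (verts F))"
    by (auto simp: graph_aut_def BijGroup_def)
  show "graph_aut F \<noteq> {}"
  proof -
    have "(\<lambda>x\<in>verts F. x) \<in> graph_aut F"
      using id_Bij[of "verts F"] by (simp add: graph_aut_def graph_iso_def Bij_def)
    then show ?thesis by blast
  qed
next
  fix f assume f: "f \<in> graph_aut F"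
  then have fB: "f \<in> Bij (verts F)" and iso: "graph_iso f F F"
    by (auto simp: graph_aut_def)
  let ?g = "\<lambda>x\<in>verts F. inv_into (verts F) f x"
  have g: "?g \<in> Bij (verts F)" using fB by (rule restrict_inv_into_Bij)
  have bf: "bij_betw f (verts F) (verts F)" using fB by (simp add: Bij_def)
  have r: "f (?g x) = x" "?g x \<in> verts F" if "x \<in> verts F" for x
    using that bf by (auto simp: bij_betw_def f_inv_into_f inv_into_into)
  have "graph_iso ?g F F"
    unfolding graph_iso_def
  proof (intro conjI ballI)
    show "bij_betw ?g (verts F) (verts F)" using g by (simp add: Bij_def)
    fix x y assume "x \<in> verts F" "y \<in> verts F"
    then show "adj F x y = adj F (?g x) (?g y)"
      using iso r unfolding graph_iso_def by metis
  qed
  then show "inv\<^bsub>BijGroup (verts F)\<^esub> f \<in> graph_aut F"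
    using g fB by (simp add: graph_aut_def inv_BijGroup)
next
  fix f g assume "f \<in> graph_aut F" "g \<in> graph_aut F"
  then have fB: "f \<in> Bij (verts F)" "g \<in> Bij (verts F)"
    and iso: "graph_iso f F F" "graph_iso g F F"
    by (auto simp: graph_aut_def)
  have c: "compose (verts F) f g \<in> Bij (verts F)" using fB by (rule compose_Bij)
  have m: "g x \<in> verts F" if "x \<in> verts F" for x
    using iso(2) that by (auto simp: graph_iso_def dest: bij_betw_apply)
  have "graph_iso (compose (verts F) f g) F F"
    unfolding graph_iso_def
  proof (intro conjI ballI)
    show "bij_betw (compose (verts F) f g) (verts F) (verts F)" using c by (simp add: Bij_def)
    fix x y assume xy: "x \<in> verts F" "y \<in> verts F"
    have "adj F x y = adj F (g x) (g y)" using iso(2) xy by (simp add: graph_iso_def)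
    also have "\<dots> = adj F (f (g x)) (f (g y))"
      using iso(1) m xy unfolding graph_iso_def by blast
    finally show "adj F x y = adj F (compose (verts F) f g x) (compose (verts F) f g y)"
      using xy by (simp add: compose_eq)
  qed
  then show "f \<otimes>\<^bsub>BijGroup (verts F)\<^esub> g \<in> graph_aut F"
    using c fB by (simp add: graph_aut_def BijGroup_def)
qed

lemma group_graph_aut_group: "group (graph_aut_group F)"
  unfolding graph_aut_group_def
  by (rule subgroup.subgroup_is_group[OF subgroup_graph_aut group_BijGroup])

section \<open>Abelian Cayley graphs\<close>

definition cayley_graph :: "'g monoid \<Rightarrow> 'g set \<Rightarrow> 'g sgraph" where
  "cayley_graph A \<Gamma> =
     \<lparr>verts = carrier A,
      adj = (\<lambda>g h. g \<in> carrier A \<and> h \<in> carrier A \<and>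
               (g \<otimes>\<^bsub>A\<^esub> inv\<^bsub>A\<^esub> h \<in> \<Gamma> \<or> h \<otimes>\<^bsub>A\<^esub> inv\<^bsub>A\<^esub> g \<in> \<Gamma>))\<rparr>"

text \<open>Being an Abelian Cayley graph is understood up to graph isomorphism. The type of the
  group elements is an explicit parameter; a theorem that leaves it free speaks about
  groups over arbitrary types.\<close>

definition abelian_cayley_graph :: "'g itself \<Rightarrow> 'a sgraph \<Rightarrow> bool" where
  "abelian_cayley_graph T G \<longleftrightarrow>
     (\<exists>(A :: 'g monoid) \<Gamma>. comm_group A \<and> \<Gamma> \<subseteq> carrier A \<and> generate A \<Gamma> = carrier A \<and>
        (\<exists>f. graph_iso f G (cayley_graph A \<Gamma>)))"

section \<open>Connections and graph bundles\<close>

text \<open>The automorphism \<open>\<phi>\<^sub>y\<^sub>x\<close> attached to the oriented edge \<open>(x, y)\<close> is written \<open>\<phi> y x\<close>.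
  The values of \<open>\<phi>\<close> on pairs of non-adjacent vertices are irrelevant.\<close>

definition connection :: "'a sgraph \<Rightarrow> 'b sgraph \<Rightarrow> ('a \<Rightarrow> 'a \<Rightarrow> 'b \<Rightarrow> 'b) \<Rightarrow> bool" where
  "connection G F \<phi> \<longleftrightarrow>
     (\<forall>x y. adj G x y \<longrightarrow>
        \<phi> y x \<in> carrier (graph_aut_group F) \<and> \<phi> x y = inv\<^bsub>graph_aut_group F\<^esub> (\<phi> y x))"

definition graph_bundle ::
    "'a sgraph \<Rightarrow> 'b sgraph \<Rightarrow> ('a \<Rightarrow> 'a \<Rightarrow> 'b \<Rightarrow> 'b) \<Rightarrow> ('a \<times> 'b) sgraph" where
  "graph_bundle G F \<phi> =
     \<lparr>verts = verts G \<times> verts F,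
      adj = (\<lambda>(x, v) (y, w).
               (x, v) \<in> verts G \<times> verts F \<and> (y, w) \<in> verts G \<times> verts F \<and>
               (x = y \<and> adj F v w \<or> adj G x y \<and> w = \<phi> y x v))\<rparr>"

definition equivalent_connections ::
    "'a sgraph \<Rightarrow> 'b sgraph \<Rightarrow> ('a \<Rightarrow> 'a \<Rightarrow> 'b \<Rightarrow> 'b) \<Rightarrow> ('a \<Rightarrow> 'a \<Rightarrow> 'b \<Rightarrow> 'b) \<Rightarrow> bool" where
  "equivalent_connections G F \<phi>\<^sub>1 \<phi>\<^sub>2 \<longleftrightarrow>
     (\<exists>f. graph_iso f (graph_bundle G F \<phi>\<^sub>1) (graph_bundle G F \<phi>\<^sub>2) \<and>
          (\<forall>p\<in>verts G \<times> verts F. fst (f p) = fst p))"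

definition identity_connection :: "'b sgraph \<Rightarrow> 'a \<Rightarrow> 'a \<Rightarrow> 'b \<Rightarrow> 'b" where
  "identity_connection F = (\<lambda>y x. \<one>\<^bsub>graph_aut_group F\<^esub>)"

definition trivial_connection ::
    "'a sgraph \<Rightarrow> 'b sgraph \<Rightarrow> ('a \<Rightarrow> 'a \<Rightarrow> 'b \<Rightarrow> 'b) \<Rightarrow> bool" where
  "trivial_connection G F \<phi> \<longleftrightarrow> equivalent_connections G F \<phi> (identity_connection F)"

definition discrete_vector_bundle ::
    "'a sgraph \<Rightarrow> 'b sgraph \<Rightarrow> ('a \<Rightarrow> 'a \<Rightarrow> 'b \<Rightarrow> 'b) \<Rightarrow> bool" where
  "discrete_vector_bundle G F \<phi> \<longleftrightarrow>
     (\<exists>z\<in>verts F. \<forall>x y. adj G x y \<longrightarrow> \<phi> y x z = z)"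

definition graph_loop :: "'a sgraph \<Rightarrow> nat \<Rightarrow> (nat \<Rightarrow> 'a) \<Rightarrow> bool" where
  "graph_loop G N x \<longleftrightarrow>
     (\<forall>i\<le>N. x i \<in> verts G) \<and> (\<forall>i<N. adj G (x i) (x (Suc i))) \<and> x 0 = x N"

primrec transport ::
    "'b sgraph \<Rightarrow> ('a \<Rightarrow> 'a \<Rightarrow> 'b \<Rightarrow> 'b) \<Rightarrow> (nat \<Rightarrow> 'a) \<Rightarrow> nat \<Rightarrow> 'b \<Rightarrow> 'b" where
  "transport F \<phi> x 0 = \<one>\<^bsub>graph_aut_group F\<^esub>"
| "transport F \<phi> x (Suc n) =
     \<phi> (x (Suc n)) (x n) \<otimes>\<^bsub>graph_aut_group F\<^esub> transport F \<phi> x n"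

definition balanced ::
    "'b sgraph \<Rightarrow> ('a \<Rightarrow> 'a \<Rightarrow> 'b \<Rightarrow> 'b) \<Rightarrow> nat \<Rightarrow> (nat \<Rightarrow> 'a) \<Rightarrow> bool" where
  "balanced F \<phi> N x \<longleftrightarrow> transport F \<phi> x N = \<one>\<^bsub>graph_aut_group F\<^esub>"

section \<open>Locally Abelian graphs\<close>

definition unit_ball :: "'a sgraph \<Rightarrow> 'a \<Rightarrow> 'a set" where
  "unit_ball G x = {x} \<union> {y \<in> verts G. adj G x y}"

definition locally_abelian :: "'a sgraph \<Rightarrow> bool" where
  "locally_abelian G \<longleftrightarrow>
     simple_graph G \<and>
     (\<exists>d. regular_graph d G \<and>
        (\<forall>x\<in>verts G. \<exists>\<eta> :: nat \<Rightarrow> 'a \<Rightarrow> 'a.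
           (\<forall>i\<in>{1..d}. \<eta> i \<in> unit_ball G x \<rightarrow> verts G) \<and>
           (\<forall>u\<in>unit_ball G x. \<forall>i\<in>{1..d}. adj G (\<eta> i u) u) \<and>
           (\<forall>u\<in>unit_ball G x. \<forall>i\<in>{1..d}. \<forall>j\<in>{1..d}. \<eta> i u = \<eta> j u \<longleftrightarrow> i = j) \<and>
           (\<forall>i\<in>{1..d}. (\<Union>j\<in>{1..d}. {\<eta> i (\<eta> j x)}) = (\<Union>j\<in>{1..d}. {\<eta> j (\<eta> i x)})) \<and>
           (\<forall>i\<in>{1..d}. \<forall>j\<in>{1..d}. \<eta> i (\<eta> j x) = \<eta> j (\<eta> i x))))"

end

theory Submission imports Defs begin

text \<open>Multiplication by the elements of a symmetric generating set of an Abelian group gives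
  commuting maps \<open>\<tau> s\<close> that enumerate, without repetition, the neighbours of every vertex. This is
  all that both halves of the theorem use of an Abelian Cayley graph
  (\<open>commuting_translations\<close>).

  Local commutativity. Near a vertex \<open>(x, v)\<close> the bundle moves either horizontally, along the lift of
  a translation of the base, or inside a fibre, along a translation of \<open>F\<close> that is carried from the
  fibre over \<open>x\<close> to the neighbouring fibres by the connection. Two lifts commute because the
  connection is balanced on 4-loops, two fibre moves because \<open>F\<close> is Abelian, and a lift commutes with
  a fibre move because the latter is conjugated by the connection
  (\<open>bundle_locally_abelian\<close>).

  Failure to be an Abelian Cayley graph. Call a section \<open>\<sigma>\<close> of the bundle parallel if the
  connection maps \<open>\<sigma> x\<close> to \<open>\<sigma> y\<close> for all adjacent \<open>x, y\<close>; the null element gives one. Let \<open>w\<close> be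
  adjacent to \<open>\<sigma> x\<close> and \<open>x\<close> to \<open>y\<close>. The four points \<open>(x, \<sigma> x)\<close>, \<open>(y, \<sigma> y)\<close>, \<open>(y, \<phi> y x w)\<close>,
  \<open>(x, w)\<close> form a 4-cycle, and because \<open>\<sigma>\<close> is parallel, opposite corners have no common neighbours
  other than the two remaining corners (\<open>square_from_section\<close>, \<open>square_across_section\<close>).
  If the bundle has commuting translations, then opposite sides of such a rigid square carry the same
  translation, with a single exception: the square may be an orbit of one translation of order four
  (\<open>vertical_step\<close>). In the exceptional case the translation \<open>s\<close> from \<open>(x, \<sigma> x)\<close>
  to \<open>(x, w)\<close> turns into its inverse over \<open>y\<close>, but then \<open>\<tau> (\<iota> s)\<close> moves \<open>(x, \<sigma> x)\<close> out of its
  fibre. So among \<open>s\<close> and \<open>\<iota> s\<close> the vertical ones still single out a vertex next to \<open>\<sigma> x\<close> in each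
  fibre consistently, and there is a parallel section through \<open>w\<close>
  (\<open>parallel_section_through_neighbour\<close>). Since \<open>F\<close> is connected, parallel sections pass
  through every vertex of one fibre, and together they trivialise the connection
  (\<open>trivial_if_parallel_sections\<close>).\<close>

section \<open>Translations of an Abelian Cayley graph\<close>

text \<open>Uniqueness of the translation between two given vertices is required at each single vertex, not
  merely for \<open>\<tau> s\<close> and \<open>\<tau> t\<close> as maps: this lets identities between translations be read off at one
  vertex.\<close>

locale commuting_translations =
  fixes G :: "'a sgraph" and S :: "'s set" and \<tau> :: "'s \<Rightarrow> 'a \<Rightarrow> 'a" and \<iota> :: "'s \<Rightarrow> 's"
  assumes closed: "\<lbrakk>s \<in> S; x \<in> verts G\<rbrakk> \<Longrightarrow> \<tau> s x \<in> verts G"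
    and commute: "\<lbrakk>s \<in> S; t \<in> S; x \<in> verts G\<rbrakk> \<Longrightarrow> \<tau> s (\<tau> t x) = \<tau> t (\<tau> s x)"
    and free: "\<lbrakk>s \<in> S; t \<in> S; x \<in> verts G; \<tau> s x = \<tau> t x\<rbrakk> \<Longrightarrow> s = t"
    and adj_iff: "\<lbrakk>x \<in> verts G; y \<in> verts G\<rbrakk> \<Longrightarrow> adj G x y \<longleftrightarrow> (\<exists>s\<in>S. y = \<tau> s x)"
    and inverse_closed: "s \<in> S \<Longrightarrow> \<iota> s \<in> S"
    and inverse: "\<lbrakk>s \<in> S; x \<in> verts G\<rbrakk> \<Longrightarrow> \<tau> (\<iota> s) (\<tau> s x) = x"
begin

lemma adj_translate: "\<lbrakk>s \<in> S; x \<in> verts G\<rbrakk> \<Longrightarrow> adj G x (\<tau> s x)"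
  using adj_iff closed by blast

lemma inverse_inverse:
  assumes "s \<in> S" "x \<in> verts G" shows "\<iota> (\<iota> s) = s"
  by (metis assms closed commute free inverse inverse_closed)

lemma inverse_unique:
  assumes "s \<in> S" "t \<in> S" "x \<in> verts G" "\<tau> s (\<tau> t x) = x" shows "s = \<iota> t"
  by (metis assms closed free inverse inverse_closed)

lemma bij_betw_neighbours:
  assumes "x \<in> verts G"
  shows "bij_betw (\<lambda>s. \<tau> s x) S {y \<in> verts G. adj G x y}"
  unfolding bij_betw_def inj_on_def
  using assms free adj_iff closed by blast

lemma finite_translations:
  assumes "locally_finite_graph G" "x \<in> verts G" shows "finite S"
  using assms bij_betw_finite[OF bij_betw_neighbours]
  unfolding locally_finite_graph_def by blast

end

lemma abelian_cayley_graph_translations: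
  assumes "abelian_cayley_graph TYPE('g) G"
  obtains S and \<tau> :: "'g \<Rightarrow> 'a \<Rightarrow> 'a" and \<iota> where "commuting_translations G S \<tau> \<iota>" "verts G \<noteq> {}"
proof -
  obtain A :: "'g monoid" and \<Gamma> f
    where A: "comm_group A" and iso: "graph_iso f G (cayley_graph A \<Gamma>)"
    using assms unfolding abelian_cayley_graph_def by blast
  interpret comm_group A by (rule A)
  define S where "S = {s \<in> carrier A. s \<in> \<Gamma> \<or> inv\<^bsub>A\<^esub> s \<in> \<Gamma>}"
  define \<tau> where "\<tau> s x = inv_into (verts G) f (s \<otimes>\<^bsub>A\<^esub> f x)" for s x
  have bij: "bij_betw f (verts G) (carrier A)"
    and adj: "\<And>x y. \<lbrakk>x \<in> verts G; y \<in> verts G\<rbrakk> \<Longrightarrow> adj G x y \<longleftrightarrow>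
      f x \<otimes>\<^bsub>A\<^esub> inv\<^bsub>A\<^esub> f y \<in> \<Gamma> \<or> f y \<otimes>\<^bsub>A\<^esub> inv\<^bsub>A\<^esub> f x \<in> \<Gamma>"
    using iso unfolding graph_iso_def cayley_graph_def by (auto dest: bij_betw_apply)
  have f: "f x \<in> carrier A" if "x \<in> verts G" for x
    using bij that by (rule bij_betw_apply)
  have f_inj: "x = y" if "f x = f y" "x \<in> verts G" "y \<in> verts G" for x y
    using bij that unfolding bij_betw_def inj_on_def by blast
  have \<tau>: "\<tau> s x \<in> verts G" "f (\<tau> s x) = s \<otimes>\<^bsub>A\<^esub> f x" if "s \<in> S" "x \<in> verts G" for s x
  proof -
    have "s \<otimes>\<^bsub>A\<^esub> f x \<in> f ` verts G"
      using that f bij unfolding S_def bij_betw_def by simp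
    then show "\<tau> s x \<in> verts G" "f (\<tau> s x) = s \<otimes>\<^bsub>A\<^esub> f x"
      unfolding \<tau>_def by (simp_all add: inv_into_into f_inv_into_f)
  qed
  have S: "s \<in> carrier A" "inv\<^bsub>A\<^esub> s \<in> S" if "s \<in> S" for s
    using that unfolding S_def by auto
  have "commuting_translations G S \<tau> (\<lambda>s. inv\<^bsub>A\<^esub> s)"
  proof
    fix s x assume s: "s \<in> S" and x: "x \<in> verts G"
    show "\<tau> s x \<in> verts G" using s x by (rule \<tau>)
    show "\<tau> (inv\<^bsub>A\<^esub> s) (\<tau> s x) = x"
      using s x by (intro f_inj) (simp_all add: \<tau> S f m_assoc[symmetric])
    fix t assume t: "t \<in> S"
    show "\<tau> s (\<tau> t x) = \<tau> t (\<tau> s x)"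
      using s t x by (intro f_inj) (simp_all add: \<tau> S f m_lcomm)
    assume "\<tau> s x = \<tau> t x"
    then have "s \<otimes>\<^bsub>A\<^esub> f x = t \<otimes>\<^bsub>A\<^esub> f x" using \<tau> s t x by metis
    then show "s = t" using s t x S f by simp
  next
    fix x y assume x: "x \<in> verts G" and y: "y \<in> verts G"
    have "y = \<tau> s x \<longleftrightarrow> s = f y \<otimes>\<^bsub>A\<^esub> inv\<^bsub>A\<^esub> f x" if "s \<in> S" for s
    proof -
      have "y = \<tau> s x \<longleftrightarrow> f y = s \<otimes>\<^bsub>A\<^esub> f x" using that x y \<tau> f_inj by metis
      also have "\<dots> \<longleftrightarrow> s = f y \<otimes>\<^bsub>A\<^esub> inv\<^bsub>A\<^esub> f x"
        using that x y S f by (metis inv_solve_right)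
      finally show ?thesis .
    qed
    then have "(\<exists>s\<in>S. y = \<tau> s x) \<longleftrightarrow> f y \<otimes>\<^bsub>A\<^esub> inv\<^bsub>A\<^esub> f x \<in> S" by simp
    also have "\<dots> \<longleftrightarrow> adj G x y"
    proof -
      have "inv\<^bsub>A\<^esub> (f y \<otimes>\<^bsub>A\<^esub> inv\<^bsub>A\<^esub> f x) = f x \<otimes>\<^bsub>A\<^esub> inv\<^bsub>A\<^esub> f y"
        using f[OF x] f[OF y] by (simp add: inv_mult_group)
      then show ?thesis
        using f[OF x] f[OF y] unfolding S_def adj[OF x y] mem_Collect_eq by (simp add: disj_commute)
    qed
    finally show "adj G x y \<longleftrightarrow> (\<exists>s\<in>S. y = \<tau> s x)" by simp
  next
    fix s assume "s \<in> S" then show "inv\<^bsub>A\<^esub> s \<in> S" by (rule S)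
  qed
  moreover have "verts G \<noteq> {}"
    using bij one_closed by (auto simp: bij_betw_def)
  ultimately show thesis by (rule that)
qed

section \<open>Graph bundles\<close>

locale graph_connection =
  fixes G :: "'a sgraph" and F :: "'b sgraph" and \<phi> :: "'a \<Rightarrow> 'a \<Rightarrow> 'b \<Rightarrow> 'b"
  assumes simple_base: "simple_graph G" and simple_fibre: "simple_graph F"
    and is_connection: "connection G F \<phi>"
begin

abbreviation "B \<equiv> graph_bundle G F \<phi>"

lemma base_verts: "adj G x y \<Longrightarrow> x \<in> verts G \<and> y \<in> verts G"
  and base_sym: "adj G x y \<Longrightarrow> adj G y x"
  and base_irrefl: "\<not> adj G x x"
  using simple_base unfolding simple_graph_def by blast+

lemma fibre_verts: "adj F v w \<Longrightarrow> v \<in> verts F \<and> w \<in> verts F"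
  and fibre_sym: "adj F v w \<Longrightarrow> adj F w v"
  and fibre_irrefl: "\<not> adj F v v"
  using simple_fibre unfolding simple_graph_def by blast+

lemma connection_iso:
  assumes "adj G x y" shows "graph_iso (\<phi> y x) F F"
  using assms is_connection
  by (auto simp: connection_def graph_aut_group_def graph_aut_def)

lemma connection_closed:
  assumes "adj G x y" "v \<in> verts F" shows "\<phi> y x v \<in> verts F"
  using connection_iso[OF assms(1)] assms(2) unfolding graph_iso_def by (auto dest: bij_betw_apply)

lemma connection_adj:
  assumes "adj G x y" "v \<in> verts F" "w \<in> verts F"
  shows "adj F (\<phi> y x v) (\<phi> y x w) \<longleftrightarrow> adj F v w"
  using connection_iso[OF assms(1)] assms(2,3) unfolding graph_iso_def by auto

lemma connection_back:
  assumes "adj G x y" "v \<in> verts F" shows "\<phi> x y (\<phi> y x v) = v"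
proof -
  let ?A = "graph_aut_group F"
  interpret A: group ?A by (rule group_graph_aut_group)
  have c: "\<phi> y x \<in> carrier ?A" "\<phi> x y = inv\<^bsub>?A\<^esub> \<phi> y x"
    using assms is_connection unfolding connection_def by auto
  have "\<phi> x y \<otimes>\<^bsub>?A\<^esub> \<phi> y x = \<one>\<^bsub>?A\<^esub>" using c by simp
  then have "compose (verts F) (\<phi> x y) (\<phi> y x) = (\<lambda>v\<in>verts F. v)"
    using c A.inv_closed[OF c(1)]
    by (simp add: graph_aut_group_def BijGroup_def graph_aut_def)
  then show ?thesis using assms(2) by (metis compose_eq restrict_apply')
qed

lemma connection_inj:
  assumes "adj G x y" "v \<in> verts F" "w \<in> verts F" "\<phi> y x v = \<phi> y x w" shows "v = w"
  using assms connection_back by metis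

lemma bundle_verts: "verts B = verts G \<times> verts F"
  by (simp add: graph_bundle_def)

lemma bundle_adj:
  "adj B (x, v) (y, w) \<longleftrightarrow>
     x \<in> verts G \<and> y \<in> verts G \<and> v \<in> verts F \<and> w \<in> verts F \<and>
     (x = y \<and> adj F v w \<or> adj G x y \<and> w = \<phi> y x v)"
  by (auto simp: graph_bundle_def)

lemma simple_bundle: "simple_graph B"
  unfolding simple_graph_def
proof (intro conjI allI impI; (elim conjE)?)
  fix p q assume "adj B p q"
  then show "p \<in> verts B" "q \<in> verts B"
    by (cases p; cases q; simp add: bundle_adj bundle_verts)+
  show "adj B q p"
    using \<open>adj B p q\<close>
    by (cases p; cases q) (auto simp: bundle_adj fibre_sym base_sym connection_back)
next
  fix p show "\<not> adj B p p"
    by (cases p) (auto simp: bundle_adj fibre_irrefl base_irrefl)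
qed

end

section \<open>Local commutativity\<close>

text \<open>Indexing the maps by an arbitrary finite set instead of \<open>{1..d}\<close> keeps horizontal and vertical
  moves apart. Enumerating all neighbours bijectively subsumes regularity as well as the first two
  conditions on the maps, and pointwise commutation implies the equality of unions.\<close>

lemma locally_abelianI:
  fixes \<mu> :: "'a \<Rightarrow> 'i \<Rightarrow> 'a \<Rightarrow> 'a"
  assumes simple: "simple_graph G" and fin: "finite I"
    and bij: "\<And>p u. \<lbrakk>p \<in> verts G; u \<in> unit_ball G p\<rbrakk>
      \<Longrightarrow> bij_betw (\<lambda>k. \<mu> p k u) I {q \<in> verts G. adj G u q}"
    and comm: "\<And>p k l. \<lbrakk>p \<in> verts G; k \<in> I; l \<in> I\<rbrakk> \<Longrightarrow> \<mu> p k (\<mu> p l p) = \<mu> p l (\<mu> p k p)"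
  shows "locally_abelian G"
proof -
  obtain e where e: "bij_betw e {1..card I} I"
    using ex_bij_betw_nat_finite_1[OF fin] by blast
  have eI: "e i \<in> I" if "i \<in> {1..card I}" for i
    using e that by (rule bij_betw_apply)
  have regular: "regular_graph (card I) G"
    unfolding regular_graph_def
  proof
    fix p assume p: "p \<in> verts G"
    then have b: "bij_betw (\<lambda>k. \<mu> p k p) I {q \<in> verts G. adj G p q}"
      by (intro bij) (auto simp: unit_ball_def)
    show "finite {q \<in> verts G. adj G p q} \<and> card {q \<in> verts G. adj G p q} = card I"
      using fin bij_betw_finite[OF b] bij_betw_same_card[OF b] by simp
  qed
  have maps: "\<exists>\<eta> :: nat \<Rightarrow> 'a \<Rightarrow> 'a.
           (\<forall>i\<in>{1..card I}. \<eta> i \<in> unit_ball G p \<rightarrow> verts G) \<and>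
           (\<forall>u\<in>unit_ball G p. \<forall>i\<in>{1..card I}. adj G (\<eta> i u) u) \<and>
           (\<forall>u\<in>unit_ball G p. \<forall>i\<in>{1..card I}. \<forall>j\<in>{1..card I}. \<eta> i u = \<eta> j u \<longleftrightarrow> i = j) \<and>
           (\<forall>i\<in>{1..card I}. (\<Union>j\<in>{1..card I}. {\<eta> i (\<eta> j p)}) = (\<Union>j\<in>{1..card I}. {\<eta> j (\<eta> i p)})) \<and>
           (\<forall>i\<in>{1..card I}. \<forall>j\<in>{1..card I}. \<eta> i (\<eta> j p) = \<eta> j (\<eta> i p))"
    if p: "p \<in> verts G" for p
  proof (intro exI[of _ "\<lambda>i. \<mu> p (e i)"] conjI ballI)
    fix i assume i: "i \<in> {1..card I}"
    have nb: "\<mu> p (e i) u \<in> {q \<in> verts G. adj G u q}" if "u \<in> unit_ball G p" for u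
      using bij_betw_apply[OF bij[OF p that] eI[OF i]] .
    then show "\<mu> p (e i) \<in> unit_ball G p \<rightarrow> verts G" by blast
    fix u assume u: "u \<in> unit_ball G p"
    show "adj G (\<mu> p (e i) u) u"
      using nb[OF u] simple unfolding simple_graph_def by blast
    fix j assume j: "j \<in> {1..card I}"
    show "\<mu> p (e i) u = \<mu> p (e j) u \<longleftrightarrow> i = j"
      using bij[OF p u] e eI i j unfolding bij_betw_def by (metis inj_on_eq_iff)
  qed (use comm[OF p] eI in auto)
  show ?thesis
    unfolding locally_abelian_def
    by (intro conjI exI[of _ "card I"] ballI simple regular maps)
qed

context graph_connection
begin

text \<open>A 4-loop around a square of the base, read as equality of the transports along its two halves.
  The corners may coincide, which covers translating by a generator and then by its inverse.\<close>

lemma balanced_square: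
  assumes bal: "\<forall>x. graph_loop G 4 x \<longrightarrow> balanced F \<phi> 4 x"
    and e: "adj G x y" "adj G y z" "adj G x y'" "adj G y' z" and v: "v \<in> verts F"
  shows "\<phi> z y (\<phi> y x v) = \<phi> z y' (\<phi> y' x v)"
proof -
  let ?A = "graph_aut_group F"
  interpret A: group ?A by (rule group_graph_aut_group)
  define c where "c = (\<lambda>i::nat. [x, y, z, y', x] ! i)"
  have c: "c 0 = x" "c (Suc 0) = y" "c (Suc (Suc 0)) = z" "c (Suc (Suc (Suc 0))) = y'"
    "c (Suc (Suc (Suc (Suc 0)))) = x"
    by (simp_all add: c_def)
  have "graph_loop G (Suc (Suc (Suc (Suc 0)))) c"
    unfolding graph_loop_def
    using e base_verts[OF e(1)] base_verts[OF e(4)] base_sym[OF e(3)] base_sym[OF e(4)]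
    by (auto simp: c le_Suc_eq less_Suc_eq)
  then have "graph_loop G 4 c" by (simp add: numeral_eq_Suc)
  then have t: "transport F \<phi> c 4 = \<one>\<^bsub>?A\<^esub>" using bal unfolding balanced_def by blast
  have car: "\<phi> q p \<in> carrier ?A" if "adj G p q" for p q
    using that is_connection unfolding connection_def by blast
  have carB: "f \<in> Bij (verts F)" if "f \<in> carrier ?A" for f
    using that by (simp add: graph_aut_group_def graph_aut_def)
  have mult: "(f \<otimes>\<^bsub>?A\<^esub> g) u = f (g u)"
    if "f \<in> carrier ?A" "g \<in> carrier ?A" "u \<in> verts F" for f g u
    using that(1,2)[THEN carB] that(3) by (simp add: graph_aut_group_def BijGroup_def compose_eq)
  have one: "\<one>\<^bsub>?A\<^esub> u = u" if "u \<in> verts F" for u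
    using that by (simp add: graph_aut_group_def BijGroup_def)
  have cs: "\<phi> y x \<in> carrier ?A" "\<phi> z y \<in> carrier ?A" "\<phi> y' z \<in> carrier ?A" "\<phi> x y' \<in> carrier ?A"
    using e base_sym car by auto
  have vs: "\<phi> y x v \<in> verts F" "\<phi> z y (\<phi> y x v) \<in> verts F"
      "\<phi> y' z (\<phi> z y (\<phi> y x v)) \<in> verts F"
    using connection_closed e base_sym v by auto
  have "v = transport F \<phi> c 4 v" using t one v by simp
  also have "\<dots> = transport F \<phi> c (Suc (Suc (Suc (Suc 0)))) v" by (simp add: numeral_eq_Suc)
  also have "\<dots> = \<phi> x y' (\<phi> y' z (\<phi> z y (\<phi> y x v)))"
    using cs v vs by (simp add: c mult one)
  finally have "\<phi> x y' (\<phi> y' z (\<phi> z y (\<phi> y x v))) = v" ..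
  then show ?thesis
    using e v by (metis base_sym connection_back connection_closed)
qed

text \<open>The moves are defined relative to the centre \<open>x\<close>: a fibre move over a neighbour \<open>y\<close> of \<open>x\<close> is the
  conjugate by the connection of a translation in the fibre over \<open>x\<close>. With non-trivial holonomy
  these conjugates need not fit together over all of \<open>G\<close>; on the unit ball around \<open>x\<close> each fibre is
  reached by a single edge from \<open>x\<close>.\<close>

theorem bundle_locally_abelian:
  assumes "commuting_translations G S \<tau> \<iota>" "finite S"
    and "commuting_translations F S' \<tau>' \<iota>'" "finite S'"
    and bal: "\<forall>x. graph_loop G 4 x \<longrightarrow> balanced F \<phi> 4 x"
  shows "locally_abelian B"
proof -
  interpret G: commuting_translations G S \<tau> \<iota> by (rule assms)
  interpret F: commuting_translations F S' \<tau>' \<iota>' by (rule assms)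
  define lift where "lift s = (\<lambda>(y, w). (\<tau> s y, \<phi> (\<tau> s y) y w))" for s
  define vert where "vert x t = (\<lambda>(y, w). (y, if y = x then \<tau>' t w else \<phi> y x (\<tau>' t (\<phi> x y w))))" for x t
  define \<mu> where "\<mu> p k = (case k of Inl s \<Rightarrow> lift s | Inr t \<Rightarrow> vert (fst p) t)" for p :: "'a \<times> 'b" and k
  have ne: "\<tau> s y \<noteq> y" if "s \<in> S" "y \<in> verts G" for s y
    using that G.adj_translate base_irrefl by metis
  have bij: "bij_betw (\<lambda>k. \<mu> p k u) (S <+> S') {q \<in> verts B. adj B u q}"
    if p: "p \<in> verts B" and u: "u \<in> unit_ball B p" for p u
  proof -
    obtain x v where xv: "p = (x, v)" by fastforce
    obtain y w where yw: "u = (y, w)" by fastforce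
    have x: "x \<in> verts G" and y: "y \<in> verts G" and w: "w \<in> verts F" and xy: "y = x \<or> adj G x y"
      using p u unfolding xv yw unit_ball_def by (auto simp: bundle_verts bundle_adj)
    have "bij_betw (\<lambda>t. snd (vert x t (y, w))) S' {w' \<in> verts F. adj F w w'}"
    proof (cases "y = x")
      case True
      then show ?thesis using F.bij_betw_neighbours[OF w] by (simp add: vert_def)
    next
      case False
      then have e: "adj G x y" "adj G y x" using xy base_sym by auto
      let ?w = "\<phi> x y w"
      have w': "?w \<in> verts F" "\<phi> y x ?w = w" using e w connection_closed connection_back by auto
      have "bij_betw (\<phi> y x) {w' \<in> verts F. adj F ?w w'} {w' \<in> verts F. adj F w w'}"
        by (rule bij_betw_byWitness[of _ "\<phi> x y"])
          (use e w w' connection_closed connection_back connection_adj in \<open>auto, metis+\<close>)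
      from bij_betw_trans[OF F.bij_betw_neighbours[OF w'(1)] this]
      show ?thesis using False by (simp add: vert_def comp_def)
    qed
    then have inj: "\<And>t t'. \<lbrakk>t \<in> S'; t' \<in> S'; snd (vert x t (y, w)) = snd (vert x t' (y, w))\<rbrakk> \<Longrightarrow> t = t'"
      and im: "(\<lambda>t. snd (vert x t (y, w))) ` S' = {w' \<in> verts F. adj F w w'}"
      unfolding bij_betw_def inj_on_def by blast+
    have vert_eq: "vert x t (y, w) = (y, snd (vert x t (y, w)))" for t
      by (simp add: vert_def)
    have nbG: "{y' \<in> verts G. adj G y y'} = (\<lambda>s. \<tau> s y) ` S"
      using G.bij_betw_neighbours[OF y] unfolding bij_betw_def by blast
    have "{q \<in> verts B. adj B u q} =
        (\<lambda>y'. (y', \<phi> y' y w)) ` {y' \<in> verts G. adj G y y'} \<union> Pair y ` {w' \<in> verts F. adj F w w'}"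
      using y w by (auto simp: yw bundle_verts bundle_adj connection_closed)
    also have "\<dots> = (\<lambda>s. lift s u) ` S \<union> (\<lambda>t. vert x t u) ` S'"
      unfolding nbG im[symmetric] image_image yw vert_eq[symmetric] by (simp add: lift_def)
    also have "\<dots> = (\<lambda>k. \<mu> p k u) ` (S <+> S')"
      by (simp add: Plus_def image_Un image_image \<mu>_def xv)
    finally have "(\<lambda>k. \<mu> p k u) ` (S <+> S') = {q \<in> verts B. adj B u q}" ..
    moreover have "inj_on (\<lambda>k. \<mu> p k u) (S <+> S')"
    proof (rule inj_onI)
      fix k l assume k: "k \<in> S <+> S'" and l: "l \<in> S <+> S'" and eq: "\<mu> p k u = \<mu> p l u"
      show "k = l"
      proof (cases k; cases l)
        fix s s' assume "k = Inl s" "l = Inl s'"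
        then show ?thesis using k l eq G.free[OF _ _ y] by (auto simp: \<mu>_def lift_def yw)
      next
        fix s t assume "k = Inl s" "l = Inr t"
        then show ?thesis using k l eq ne[OF _ y] by (auto simp: \<mu>_def lift_def vert_def yw)
      next
        fix s t assume "k = Inr t" "l = Inl s"
        then show ?thesis using k l eq ne[OF _ y, THEN not_sym] by (auto simp: \<mu>_def lift_def vert_def yw)
      next
        fix t t' assume "k = Inr t" "l = Inr t'"
        then show ?thesis using k l eq inj by (auto simp: \<mu>_def xv yw)
      qed
    qed
    ultimately show ?thesis unfolding bij_betw_def by blast
  qed
  have comm: "\<mu> p k (\<mu> p l p) = \<mu> p l (\<mu> p k p)"
    if p: "p \<in> verts B" and k: "k \<in> S <+> S'" and l: "l \<in> S <+> S'" for p k l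
  proof -
    obtain x v where xv: "p = (x, v)" by fastforce
    have x: "x \<in> verts G" and v: "v \<in> verts F" using p by (auto simp: xv bundle_verts)
    have hh: "lift s (lift s' (x, v)) = lift s' (lift s (x, v))" if "s \<in> S" "s' \<in> S" for s s'
    proof -
      have "\<tau> s (\<tau> s' x) = \<tau> s' (\<tau> s x)" using that x by (rule G.commute)
      then show ?thesis
        using balanced_square[OF bal G.adj_translate[OF that(2) x] _ G.adj_translate[OF that(1) x] _ v]
          G.adj_translate[OF that(1) G.closed[OF that(2) x]]
          G.adj_translate[OF that(2) G.closed[OF that(1) x]]
        by (simp add: lift_def)
    qed
    have hv: "lift s (vert x t (x, v)) = vert x t (lift s (x, v))" if "s \<in> S" "t \<in> S'" for s t
      using that x v ne G.adj_translate connection_back by (simp add: lift_def vert_def)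
    have vv: "vert x t (vert x t' (x, v)) = vert x t' (vert x t (x, v))" if "t \<in> S'" "t' \<in> S'" for t t'
      using that v F.commute by (simp add: vert_def)
    show ?thesis
      using k l hh hv vv by (auto simp: \<mu>_def xv)
  qed
  show ?thesis
    by (rule locally_abelianI[OF simple_bundle finite_Plus[OF assms(2,4)] bij comm])
qed

section \<open>Parallel sections\<close>

definition parallel :: "('a \<Rightarrow> 'b) \<Rightarrow> bool" where
  "parallel \<sigma> \<longleftrightarrow> (\<forall>x\<in>verts G. \<sigma> x \<in> verts F) \<and> (\<forall>x y. adj G x y \<longrightarrow> \<sigma> y = \<phi> y x (\<sigma> x))"

lemma parallel_closed: "\<lbrakk>parallel \<sigma>; x \<in> verts G\<rbrakk> \<Longrightarrow> \<sigma> x \<in> verts F"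
  and parallel_step: "\<lbrakk>parallel \<sigma>; adj G x y\<rbrakk> \<Longrightarrow> \<phi> y x (\<sigma> x) = \<sigma> y"
  unfolding parallel_def by auto

text \<open>A third common neighbour would lie over some \<open>z\<close> different from \<open>x\<close> and \<open>y\<close>. Being adjacent to
  \<open>(x, \<sigma> x)\<close> it would be \<open>(z, \<sigma> z)\<close>, and following it back to \<open>y\<close> would put \<open>\<phi> y x w\<close> on the section.
  Parallelism enters along the edges at \<open>z\<close>, not only along the one from \<open>x\<close> to \<open>y\<close>.\<close>

lemma square_from_section:
  assumes "parallel \<sigma>" "adj G x y" "adj F (\<sigma> x) w"
    and "adj B (x, \<sigma> x) q" "adj B (y, \<phi> y x w) q"
  shows "q = (y, \<sigma> y) \<or> q = (x, w)"
proof -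
  obtain z u where q: "q = (z, u)" by fastforce
  have w: "w \<in> verts F" "w \<noteq> \<sigma> x" using assms(3) fibre_verts fibre_irrefl by auto
  from assms(4) consider "z = x" | "adj G x z" "u = \<sigma> z"
    using parallel_step[OF assms(1)] by (auto simp: q bundle_adj)
  then show ?thesis
  proof cases
    case 1
    then have "u = \<phi> x y (\<phi> y x w)"
      using assms(2,5) base_irrefl by (auto simp: q bundle_adj)
    then show ?thesis using 1 w assms(2) connection_back q by simp
  next
    case 2
    have "z = y"
    proof (rule ccontr)
      assume "z \<noteq> y"
      then have e: "adj G y z" "\<sigma> z = \<phi> z y (\<phi> y x w)" using assms(5) 2 by (auto simp: q bundle_adj)
      then have "\<phi> y x w = \<sigma> y"
        using connection_back[OF e(1)] connection_closed[OF assms(2) w(1)]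
          parallel_step[OF assms(1) base_sym[OF e(1)]] by metis
      then have "w = \<sigma> x"
        using connection_inj[OF assms(2) w(1)] parallel_closed[OF assms(1)]
          parallel_step[OF assms(1,2)] base_verts[OF assms(2)] by metis
      then show False using w by simp
    qed
    then show ?thesis using 2 q by simp
  qed
qed

text \<open>The other diagonal of the same square: exchanging \<open>x\<close> and \<open>y\<close> turns it into the first one.\<close>

lemma square_across_section:
  assumes "parallel \<sigma>" "adj G x y" "adj F (\<sigma> x) w"
    and "adj B (y, \<sigma> y) q" "adj B (x, w) q"
  shows "q = (x, \<sigma> x) \<or> q = (y, \<phi> y x w)"
proof (rule square_from_section[OF assms(1) base_sym[OF assms(2)] _ assms(4)])
  have w: "w \<in> verts F" "\<sigma> x \<in> verts F" using assms(3) fibre_verts by auto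
  show "adj F (\<sigma> y) (\<phi> y x w)"
    using assms(3) connection_adj[OF assms(2) w(2,1)] parallel_step[OF assms(1,2)] by simp
  show "adj B (x, \<phi> x y (\<phi> y x w)) q"
    using assms(5) connection_back[OF assms(2) w(1)] by simp
qed

text \<open>Sending \<open>v\<close> to the value at \<open>x\<close> of the section that starts in \<open>v\<close> is an automorphism \<open>H x\<close> of \<open>F\<close>,
  being the identity at \<open>x\<^sub>0\<close> and changing by \<open>\<phi>\<close> along each edge. The inverses of the \<open>H x\<close> form
  the isomorphism to the Cartesian product.\<close>

lemma trivial_if_parallel_sections:
  assumes conn: "connected_graph G" and x\<^sub>0: "x\<^sub>0 \<in> verts G"
    and sections: "\<And>v. v \<in> verts F \<Longrightarrow> \<exists>\<sigma>. parallel \<sigma> \<and> \<sigma> x\<^sub>0 = v"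
  shows "trivial_connection G F \<phi>"
proof -
  obtain \<Sigma> where \<Sigma>: "\<And>v. v \<in> verts F \<Longrightarrow> parallel (\<Sigma> v)" "\<And>v. v \<in> verts F \<Longrightarrow> \<Sigma> v x\<^sub>0 = v"
    using sections by metis
  define H where "H x v = \<Sigma> v x" for x v
  have H_step: "H y v = \<phi> y x (H x v)" if "adj G x y" "v \<in> verts F" for x y v
    using that \<Sigma>(1) parallel_step unfolding H_def by metis
  have iso: "graph_iso (H x) F F" if "x \<in> verts G" for x
  proof -
    have "(adj G)\<^sup>*\<^sup>* x\<^sub>0 x" using conn x\<^sub>0 that unfolding connected_graph_def by blast
    then show ?thesis
    proof induction
      case base
      have id: "H x\<^sub>0 v = v" if "v \<in> verts F" for v
        using that \<Sigma>(2) by (simp add: H_def)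
      then have "bij_betw (H x\<^sub>0) (verts F) (verts F)"
        using bij_betw_cong[of "verts F" "H x\<^sub>0" id] by simp
      then show ?case by (simp add: graph_iso_def id)
    next
      case (step y z)
      have b: "bij_betw (H y) (verts F) (verts F)" using step.IH unfolding graph_iso_def by blast
      have "bij_betw (\<phi> z y \<circ> H y) (verts F) (verts F)"
        using b connection_iso[OF step.hyps(2)] unfolding graph_iso_def by (blast intro: bij_betw_trans)
      moreover have "bij_betw (H z) (verts F) (verts F) \<longleftrightarrow> bij_betw (\<phi> z y \<circ> H y) (verts F) (verts F)"
        by (rule bij_betw_cong) (simp add: H_step[OF step.hyps(2)])
      ultimately show ?case
        using step.IH bij_betw_apply[OF b]
        by (simp add: graph_iso_def H_step[OF step.hyps(2)] connection_adj[OF step.hyps(2)])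
    qed
  qed
  define K where "K x = inv_into (verts F) (H x)" for x
  have H_closed: "H x v \<in> verts F" and KH: "K x (H x v) = v" if "x \<in> verts G" "v \<in> verts F" for x v
    using iso[OF that(1)] that(2) unfolding graph_iso_def K_def
    by (auto simp: bij_betw_inv_into_left dest: bij_betw_apply)
  have K_closed: "K x w \<in> verts F" and HK: "H x (K x w) = w" if "x \<in> verts G" "w \<in> verts F" for x w
    using iso[OF that(1)] that(2) unfolding graph_iso_def K_def
    by (auto simp: bij_betw_inv_into_right dest: bij_betw_apply[OF bij_betw_inv_into])
  have H_adj: "adj F (H x v) (H x w) \<longleftrightarrow> adj F v w"
    if "x \<in> verts G" "v \<in> verts F" "w \<in> verts F" for x v w
    using iso[OF that(1)] that(2,3) unfolding graph_iso_def by blast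
  let ?k = "\<lambda>(x, w). (x, K x w)"
  have "bij_betw ?k (verts G \<times> verts F) (verts G \<times> verts F)"
    by (rule bij_betw_byWitness[of _ "\<lambda>(x, v). (x, H x v)"]) (auto simp: H_closed K_closed HK KH)
  moreover have "adj B (x, w) (y, u) \<longleftrightarrow>
      adj (graph_bundle G F (identity_connection F)) (x, K x w) (y, K y u)"
    if xy: "x \<in> verts G" "y \<in> verts G" and wu: "w \<in> verts F" "u \<in> verts F" for x y w u
  proof -
    have "adj F w u \<longleftrightarrow> adj F (K x w) (K x u)"
      using H_adj[OF xy(1) K_closed[OF xy(1) wu(1)] K_closed[OF xy(1) wu(2)]] HK xy wu by simp
    moreover have "u = \<phi> y x w \<longleftrightarrow> K y u = K x w" if "adj G x y"
      using H_step[OF that K_closed[OF xy(1) wu(1)]] HK KH K_closed xy wu by metis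
    ultimately show ?thesis
      using xy wu K_closed
      by (auto simp: graph_bundle_def identity_connection_def graph_aut_group_def BijGroup_def)
  qed
  ultimately have "graph_iso ?k B (graph_bundle G F (identity_connection F))"
    unfolding graph_iso_def by (auto simp: graph_bundle_def)
  then show ?thesis
    unfolding trivial_connection_def equivalent_connections_def by (intro exI[of _ ?k]) auto
qed

end

section \<open>Flatness forced by commuting translations\<close>

locale translation_bundle = graph_connection G F \<phi> + B: commuting_translations "graph_bundle G F \<phi>" S \<tau> \<iota>
  for G :: "'a sgraph" and F :: "'b sgraph" and \<phi> and S :: "'s set" and \<tau> and \<iota>
begin

text \<open>The translations that lead from \<open>(x, \<sigma> x)\<close> to its neighbours in the same fibre; all others in
  \<open>S\<close> follow the section to a neighbouring fibre, as \<open>\<sigma>\<close> is parallel.\<close>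

definition vertical :: "('a \<Rightarrow> 'b) \<Rightarrow> 'a \<Rightarrow> 's \<Rightarrow> bool" where
  "vertical \<sigma> x s \<longleftrightarrow> s \<in> S \<and> fst (\<tau> s (x, \<sigma> x)) = x"

text \<open>Let \<open>a\<close>, \<open>s\<close> be the translations along the two sides of the square at \<open>(x, \<sigma> x)\<close>, and \<open>d\<close> the
  one along the vertical side at \<open>(y, \<sigma> y)\<close>. Since \<open>\<tau> a\<close> and \<open>\<tau> d\<close> commute, \<open>\<tau> d (x, \<sigma> x)\<close> is a common
  neighbour of two opposite corners, so \<open>d\<close> is \<open>s\<close> or \<open>a\<close>. If \<open>d = a\<close>, the same argument for
  \<open>\<tau> a (x, w)\<close> and the other diagonal shows that \<open>a\<close> is inverse to \<open>s\<close>; and \<open>a\<close> is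
  horizontal.\<close>

lemma vertical_step:
  assumes \<sigma>: "parallel \<sigma>" and e: "adj G x y" and s: "vertical \<sigma> x s"
  obtains t where "vertical \<sigma> y t" "\<tau> t (y, \<sigma> y) = (y, \<phi> y x (snd (\<tau> s (x, \<sigma> x))))"
    "t = s \<or> t = \<iota> s \<and> \<not> vertical \<sigma> x (\<iota> s)"
proof -
  define w where "w = snd (\<tau> s (x, \<sigma> x))"
  have sS: "s \<in> S" and sw: "\<tau> s (x, \<sigma> x) = (x, w)"
    using s by (auto simp: vertical_def w_def prod_eq_iff)
  have xy: "x \<in> verts G" "y \<in> verts G" "x \<noteq> y" using e base_verts base_irrefl by auto
  have g: "(x, \<sigma> x) \<in> verts B" "(y, \<sigma> y) \<in> verts B"
    using xy parallel_closed[OF \<sigma>] by (auto simp: bundle_verts)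
  have xw: "adj F (\<sigma> x) w"
    using B.adj_translate[OF sS g(1)] base_irrefl by (auto simp: sw bundle_adj)
  have w: "w \<in> verts F" "\<sigma> x \<in> verts F" using xw fibre_verts by auto
  have "adj B (x, \<sigma> x) (y, \<sigma> y)"
    using e g parallel_step[OF \<sigma> e] by (simp add: bundle_adj bundle_verts)
  then obtain a where a: "a \<in> S" "\<tau> a (x, \<sigma> x) = (y, \<sigma> y)" using B.adj_iff g by metis
  have k: "(y, \<phi> y x w) \<in> verts B" using xy w connection_closed[OF e] by (simp add: bundle_verts)
  have "adj B (y, \<sigma> y) (y, \<phi> y x w)"
    using g k xw connection_adj[OF e w(2,1)] parallel_step[OF \<sigma> e] by (simp add: bundle_adj bundle_verts)
  then obtain d where d: "d \<in> S" "\<tau> d (y, \<sigma> y) = (y, \<phi> y x w)" using B.adj_iff g k by metis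
  have "adj B (x, \<sigma> x) (\<tau> d (x, \<sigma> x))" using B.adj_translate d g by blast
  moreover have "adj B (y, \<phi> y x w) (\<tau> d (x, \<sigma> x))"
  proof -
    have "\<tau> a (\<tau> d (x, \<sigma> x)) = (y, \<phi> y x w)" using B.commute[OF a(1) d(1) g(1)] a d by simp
    then have "adj B (\<tau> d (x, \<sigma> x)) (y, \<phi> y x w)"
      using B.adj_translate[OF a(1) B.closed[OF d(1) g(1)]] by simp
    then show ?thesis using simple_bundle unfolding simple_graph_def by blast
  qed
  ultimately have "\<tau> d (x, \<sigma> x) = (y, \<sigma> y) \<or> \<tau> d (x, \<sigma> x) = (x, w)"
    by (rule square_from_section[OF \<sigma> e xw])
  then have "d = a \<or> d = s" using B.free[OF d(1) _ g(1)] a sS sw by metis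
  moreover have "a = \<iota> s" if "d = a"
  proof -
    have "adj B (y, \<sigma> y) (\<tau> s (y, \<sigma> y))" using B.adj_translate sS g by blast
    moreover have "adj B (x, w) (\<tau> s (y, \<sigma> y))"
    proof -
      have "\<tau> a (x, w) = \<tau> s (y, \<sigma> y)" using B.commute[OF a(1) sS g(1)] a sw by simp
      then show ?thesis
        using B.adj_translate[OF a(1), of "(x, w)"] xy w by (simp add: bundle_verts)
    qed
    ultimately consider "\<tau> s (y, \<sigma> y) = (x, \<sigma> x)" | "\<tau> s (y, \<sigma> y) = (y, \<phi> y x w)"
      using square_across_section[OF \<sigma> e xw] by blast
    then show ?thesis
    proof cases
      case 1
      then have "\<tau> a (\<tau> s (x, \<sigma> x)) = (x, \<sigma> x)" using B.commute[OF a(1) sS g(1)] a by simp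
      then show ?thesis using B.inverse_unique[OF a(1) sS g(1)] by simp
    next
      case 2
      then have "s = d" using B.free[OF sS d(1) g(2)] d by simp
      then show ?thesis using that a sw xy by simp
    qed
  qed
  moreover have "\<not> vertical \<sigma> x a" using a xy by (simp add: vertical_def)
  moreover have "vertical \<sigma> y d" using d by (simp add: vertical_def)
  ultimately show thesis using that[of d] d(2) unfolding w_def by blast
qed

text \<open>The new section follows the vertical translation among \<open>s\<close> and \<open>\<iota> s\<close>. Either both are vertical over
  every vertex, and then \<open>s\<close> never flips, or over every vertex exactly one is vertical, and then
  there is no choice.\<close>

lemma parallel_section_through_neighbour:
  assumes conn: "connected_graph G" and \<sigma>: "parallel \<sigma>" and x\<^sub>0: "x\<^sub>0 \<in> verts G"
    and w\<^sub>0: "adj F (\<sigma> x\<^sub>0) w\<^sub>0"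
  shows "\<exists>\<sigma>'. parallel \<sigma>' \<and> \<sigma>' x\<^sub>0 = w\<^sub>0"
proof -
  have g: "(x, \<sigma> x) \<in> verts B" if "x \<in> verts G" for x
    using that parallel_closed[OF \<sigma>] by (auto simp: bundle_verts)
  have "adj B (x\<^sub>0, \<sigma> x\<^sub>0) (x\<^sub>0, w\<^sub>0)"
    using x\<^sub>0 w\<^sub>0 fibre_verts by (auto simp: bundle_adj)
  then obtain s where s: "s \<in> S" "\<tau> s (x\<^sub>0, \<sigma> x\<^sub>0) = (x\<^sub>0, w\<^sub>0)"
    using B.adj_iff[OF g[OF x\<^sub>0], of "(x\<^sub>0, w\<^sub>0)"] x\<^sub>0 w\<^sub>0 fibre_verts by (auto simp: bundle_verts)
  have ss: "\<iota> (\<iota> s) = s" using B.inverse_inverse[OF s(1) g[OF x\<^sub>0]] .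
  define both where "both x \<longleftrightarrow> vertical \<sigma> x s \<and> vertical \<sigma> x (\<iota> s)" for x
  define label where "label x = (if vertical \<sigma> x s then s else \<iota> s)" for x
  define \<sigma>' where "\<sigma>' x = snd (\<tau> (label x) (x, \<sigma> x))" for x
  \<comment> \<open>As edges are symmetric, this makes \<open>both\<close> constant along edges.\<close>
  have both_step: "both y" if "adj G x y" "both x" for x y
    using that ss unfolding both_def by (metis vertical_step[OF \<sigma>])
  have step: "vertical \<sigma> y (label y) \<and> \<sigma>' y = \<phi> y x (\<sigma>' x)"
    if e: "adj G x y" and x: "vertical \<sigma> x (label x)" for x y
  proof -
    obtain t where t: "vertical \<sigma> y t" "\<tau> t (y, \<sigma> y) = (y, \<phi> y x (\<sigma>' x))"
      "t = label x \<or> t = \<iota> (label x) \<and> \<not> vertical \<sigma> x (\<iota> (label x))"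
      unfolding \<sigma>'_def by (rule vertical_step[OF \<sigma> e x])
    have "t = label y"
    proof (cases "both x")
      case True
      then have "both y" using both_step e by blast
      then show ?thesis using True t(3) unfolding both_def label_def by auto
    next
      case False
      then have "\<not> both y" using both_step base_sym e by blast
      moreover have "t = s \<or> t = \<iota> s" using t(3) ss unfolding label_def by (auto split: if_splits)
      ultimately show ?thesis using t(1) unfolding both_def label_def by auto
    qed
    then show ?thesis using t unfolding \<sigma>'_def by simp
  qed
  have s0: "vertical \<sigma> x\<^sub>0 s" using s by (simp add: vertical_def)
  have vert: "vertical \<sigma> x (label x)" if "x \<in> verts G" for x
  proof -
    have "(adj G)\<^sup>*\<^sup>* x\<^sub>0 x" using conn x\<^sub>0 that unfolding connected_graph_def by blast
    then show ?thesis
      by induction (use s0 step in \<open>auto simp: label_def\<close>)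
  qed
  have "\<sigma>' x \<in> verts F" if "x \<in> verts G" for x
    using B.closed[OF _ g[OF that]] vert[OF that] unfolding \<sigma>'_def vertical_def
    by (metis bundle_verts mem_Times_iff)
  then have "parallel \<sigma>'"
    unfolding parallel_def using step vert base_verts by blast
  moreover have "\<sigma>' x\<^sub>0 = w\<^sub>0" using s s0 by (simp add: \<sigma>'_def label_def)
  ultimately show ?thesis by blast
qed

theorem connection_trivial:
  assumes conn: "connected_graph G" and conn': "connected_graph F" and ne: "verts G \<noteq> {}"
    and zero: "discrete_vector_bundle G F \<phi>"
  shows "trivial_connection G F \<phi>"
proof -
  obtain x\<^sub>0 where x\<^sub>0: "x\<^sub>0 \<in> verts G" using ne by blast
  obtain z where z: "z \<in> verts F" "\<And>x y. adj G x y \<Longrightarrow> \<phi> y x z = z"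
    using zero unfolding discrete_vector_bundle_def by blast
  have "\<exists>\<sigma>. parallel \<sigma> \<and> \<sigma> x\<^sub>0 = v" if "v \<in> verts F" for v
  proof -
    have "(adj F)\<^sup>*\<^sup>* z v" using conn' z(1) that unfolding connected_graph_def by blast
    then show ?thesis
    proof induction
      case base
      show ?case by (rule exI[of _ "\<lambda>_. z"]) (simp add: parallel_def z)
    next
      case (step v w)
      then show ?case using parallel_section_through_neighbour[OF conn _ x\<^sub>0] by metis
    qed
  qed
  then show ?thesis by (rule trivial_if_parallel_sections[OF conn x\<^sub>0])
qed

end

theorem theorem4:
  fixes G :: "'a sgraph" and F :: "'b sgraph"
    and \<phi> :: "'a \<Rightarrow> 'a \<Rightarrow> 'b \<Rightarrow> 'b"
  assumes "simple_graph G" and "locally_finite_graph G" and "connected_graph G"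
    and "abelian_cayley_graph TYPE('g) G"
    and "simple_graph F" and "locally_finite_graph F" and "connected_graph F"
    and "abelian_cayley_graph TYPE('h) F"
    and "connection G F \<phi>"
    and "\<not> trivial_connection G F \<phi>"
    and "\<forall>x. graph_loop G 4 x \<longrightarrow> balanced F \<phi> 4 x"
    and "discrete_vector_bundle G F \<phi>"
  shows "locally_abelian (graph_bundle G F \<phi>) \<and>
         \<not> abelian_cayley_graph TYPE('c) (graph_bundle G F \<phi>)"
proof
  interpret graph_connection G F \<phi> by unfold_locales (fact assms)+
  obtain S and \<tau> :: "'g \<Rightarrow> 'a \<Rightarrow> 'a" and \<iota> where
    G: "commuting_translations G S \<tau> \<iota>" "verts G \<noteq> {}"
    using assms(4) by (rule abelian_cayley_graph_translations)
  obtain S' and \<tau>' :: "'h \<Rightarrow> 'b \<Rightarrow> 'b" and \<iota>' where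
    F: "commuting_translations F S' \<tau>' \<iota>'" "verts F \<noteq> {}"
    using assms(8) by (rule abelian_cayley_graph_translations)
  have "finite S"
    using G(2) commuting_translations.finite_translations[OF G(1) assms(2)] by blast
  moreover have "finite S'"
    using F(2) commuting_translations.finite_translations[OF F(1) assms(6)] by blast
  ultimately show "locally_abelian B"
    using G(1) F(1) assms(11) by (intro bundle_locally_abelian)
  show "\<not> abelian_cayley_graph TYPE('c) B"
  proof
    assume "abelian_cayley_graph TYPE('c) B"
    then obtain T and \<rho> :: "'c \<Rightarrow> 'a \<times> 'b \<Rightarrow> 'a \<times> 'b" and \<kappa> where
      "commuting_translations B T \<rho> \<kappa>"
      by (rule abelian_cayley_graph_translations)
    then interpret B: translation_bundle G F \<phi> T \<rho> \<kappa>
      unfolding translation_bundle_def using graph_connection_axioms by blast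
    show False
      using B.connection_trivial[OF assms(3,7) G(2) assms(12)] assms(10) by blast
  qed
qed

end
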